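(* Let $z_2>z_1>0$, let $Q(z)=(z_1-z)(z_2-z)$, and let $(H_n(x))_{n\ge 0}$ be the sequence of polynomials generated by $$\sum_{n=0}^{\infty}H_n(x)\frac{z^n}{n!}=Q(z)^{x}Q(-z)^{1-x}\qquad (z,x\in\mathbb{C}).$$ Then for all sufficiently large $n$, other than the two trivial zeros at $x=0$ and $x=1$, all the zeros of $H_n(x)$ lie on the critical line $\operatorname{Re} x=1/2$.
   Context: The generating identity is understood as a power series identity in $z$ near $z=0$, where $Q(0)=z_1z_2>0$ and complex powers are taken with the principal logarithm, i.e. $Q(z)^xQ(-z)^{1-x}=\exp\left(x\operatorname{Log}Q(z)+(1-x)\operatorname{Log}Q(-z)\right)$. "Sufficiently large" may depend on $z_1,z_2$. *)

theory Defs
  imports "HOL-Analysis.Analysis" "HOL-Computational_Algebra.Polynomial"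
begin

definition Q :: "real \<Rightarrow> real \<Rightarrow> complex \<Rightarrow> complex" where
  "Q z1 z2 z = (of_real z1 - z) * (of_real z2 - z)"

(* Complex powr is exp (x * Ln w) with the principal branch Ln for w \<noteq> 0. For 0 < z1 < z2 both
   bases are nonzero near z = 0, so the convention 0 powr x = 0 plays no role in the germ at 0. *)
definition gen_fun :: "real \<Rightarrow> real \<Rightarrow> complex \<Rightarrow> complex \<Rightarrow> complex" where
  "gen_fun z1 z2 x z = Q z1 z2 z powr x * Q z1 z2 (- z) powr (1 - x)"

end

theory Submission
  imports Defs "HOL-Complex_Analysis.Laurent_Convergence"
begin

text \<open>
  Write \<open>s = 1/z1 + 1/z2\<close>, \<open>\<rho> = 1/(z1 z2)\<close>, \<open>\<delta> = (1/z1 - 1/z2)\<^sup>2\<close>, so that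
  \<open>s\<^sup>2 = 4 \<rho> + \<delta>\<close>, and \<open>w = (1 - 2 x) s\<close>. The critical line is \<open>Re w = 0\<close>. The proof is algebraic,
  uses no asymptotics in \<open>n\<close>, and gives the conclusion for every \<open>n \<ge> 3\<close>.

  The generating function is \<open>z1 z2 (1 - s z + \<rho> z\<^sup>2) ((1 + s z + \<rho> z\<^sup>2) / (1 - s z + \<rho> z\<^sup>2))\<^sup>1\<^sup>-\<^sup>x\<close>,
  a function of \<open>\<zeta> = s z / (1 + \<rho> z\<^sup>2)\<close> up to the factor \<open>1 + \<rho> z\<^sup>2\<close>. Expanding in powers of \<open>\<zeta>\<close>,
  and noting that \<open>1 / (1 + \<rho> z\<^sup>2 - X z)\<close> generates the Lucas polynomials \<open>W\<^sub>n\<close> (rescaled Chebyshev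
  polynomials of the second kind), one is led to
  \[ H_n(x) / n! = 2 z_1 z_2 s^2 \, x (x - 1) \, T_w(W_{n-1}) \qquad (n \ge 3), \]
  where \<open>T\<^sub>w\<close> is the linear functional on polynomials in \<open>X\<close> given, for \<open>-1 < Re x < 2\<close>, by
  integration against a multiple of the Jacobi weight \<open>(s - X)\<^sup>x (s + X)\<^sup>1\<^sup>-\<^sup>x\<close> on \<open>[-s, s]\<close>. Here it is
  described by its moments, and the identity is checked by comparing recurrences: the one for \<open>H\<^sub>n\<close>
  comes from the first-order differential equation of the generating function
  (\<open>gen_fun_coeff_rec\<close>), the other one from integration by parts
  (\<open>moment_functional_lucas_poly_rec\<close>), and \<open>moment_functional_solves_rec\<close> matches them.
  The factor \<open>x (x - 1)\<close> carries the two trivial zeros.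

  It remains to see that \<open>T\<^sub>w(W\<^sub>n)\<close> does not vanish off the line \<open>Re w = 0\<close>
  (\<open>moment_functional_lucas_poly_nonzero\<close>). Let \<open>G k n\<close> be the value of \<open>T\<^sub>w\<close> at the \<open>k\<close>-th derivative
  of \<open>W\<^sub>n\<close>. Integration by parts turns the differential equation of \<open>W\<close> into
  \[ (n-k)(n-k+2)\, G\,k\,(n+1) = w\, G\,(k+1)\,(n+1) + \delta\, G\,(k+2)\,(n+1) + 4 k \rho\, G\,(k+1)\,n . \]
  For \<open>k \<le> n\<close> all the coefficients other than \<open>w\<close> are nonnegative reals. Multiplying by the conjugate of
  \<open>G (k+1) (n+1)\<close> and taking real parts therefore shows, by an induction that goes up in \<open>n\<close> and down
  in \<open>k\<close>, that \<open>Re (G k (n+1) * cnj (G (k+1) (n+1)))\<close> never has the sign opposite to that of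
  \<open>Re w\<close>; the last term is under control because \<open>G (k+1) (n+1) - \<rho> G (k+1) (n-1) = n G k n\<close>.
  The term \<open>Re w * |G (k+1) (n+1)|\<^sup>2\<close> is a surplus in this argument: if \<open>G 0 (n+1)\<close> vanished, then all
  \<open>G k (n+1)\<close> would have to vanish in turn, but \<open>G n (n+1) = n!\<close>.
\<close>

section \<open>Lucas polynomials and their derivatives\<close>

text \<open>
  The sequence \<open>W\<^sub>n\<close> starts at \<open>W\<^sub>0 = 0\<close> rather than at \<open>1\<close>, so that \<open>W\<^sub>n\<close> has degree \<open>n - 1\<close> and the
  identities below hold from \<open>n = 0\<close> on.
\<close>

fun lucas_poly :: "'a::comm_ring_1 \<Rightarrow> nat \<Rightarrow> 'a poly" where
  "lucas_poly r 0 = 0"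
| "lucas_poly r (Suc 0) = 1"
| "lucas_poly r (Suc (Suc n)) = [:0, 1:] * lucas_poly r (Suc n) - [:r:] * lucas_poly r n"

lemma pderiv_X_mult:
  fixes p :: "'a::idom poly"
  shows "pderiv ([:0, 1:] * p) = p + [:0, 1:] * pderiv p"
  by (simp add: pderiv_mult pderiv_pCons)

lemma pderiv_const_mult:
  fixes p :: "'a::idom poly"
  shows "pderiv ([:c:] * p) = [:c:] * pderiv p" "pderiv (of_nat m * p) = of_nat m * pderiv p"
  by (simp_all add: pderiv_mult pderiv_smult)

text \<open>
  These are the derivative relations familiar from Chebyshev polynomials of the second kind. The second
  one at \<open>n\<close> needs both at smaller indices, and the first one at \<open>n\<close> needs the second, hence the joint
  induction.
\<close>

lemma pderiv_lucas_poly: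
  fixes r :: "'a::idom"
  shows "pderiv (lucas_poly r (Suc (Suc n))) =
           [:r:] * pderiv (lucas_poly r n) + of_nat (Suc n) * lucas_poly r (Suc n)"
    and "[:0, 1:] * pderiv (lucas_poly r (Suc n)) =
           of_nat n * lucas_poly r (Suc n) + 2 * [:r:] * pderiv (lucas_poly r n)"
proof -
  let ?X = "[:0, 1:] :: 'a poly" and ?R = "[:r:] :: 'a poly" and ?W = "lucas_poly r"
  have step: "pderiv (?W (Suc (Suc m))) = ?W (Suc m) + ?X * pderiv (?W (Suc m)) - ?R * pderiv (?W m)" for m
    by (simp only: lucas_poly.simps pderiv_diff pderiv_X_mult pderiv_const_mult)
  have "pderiv (?W (Suc (Suc n))) = ?R * pderiv (?W n) + of_nat (Suc n) * ?W (Suc n) \<and>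
        ?X * pderiv (?W (Suc n)) = of_nat n * ?W (Suc n) + 2 * ?R * pderiv (?W n)"
  proof (induction n rule: less_induct)
    case (less n)
    have C: "?X * pderiv (?W (Suc n)) = of_nat n * ?W (Suc n) + 2 * ?R * pderiv (?W n)"
    proof -
      consider "n = 0" | "n = Suc 0" | m where "n = Suc (Suc m)"
        by (metis not0_implies_Suc)
      then show ?thesis
      proof cases
        case 1
        then show ?thesis by simp
      next
        case 2
        then show ?thesis by (simp add: pderiv_pCons)
      next
        case n: (3 m)
        have B1: "pderiv (?W n) = ?R * pderiv (?W m) + of_nat (Suc m) * ?W (Suc m)"
          using less.IH[of m] n by auto
        have B2: "pderiv (?W (Suc n)) =
            ?R * pderiv (?W (Suc m)) + of_nat (Suc (Suc m)) * ?W (Suc (Suc m))"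
          using less.IH[of "Suc m"] n by auto
        have C1: "?X * pderiv (?W (Suc m)) = of_nat m * ?W (Suc m) + 2 * ?R * pderiv (?W m)"
          using less.IH[of m] n by auto
        have A: "?W (Suc n) = ?X * ?W (Suc (Suc m)) - ?R * ?W (Suc m)"
          using n by simp
        have ofn: "of_nat n = (of_nat m + 2 :: 'a poly)" using n by simp
        have "?X * pderiv (?W (Suc n)) =
                ?R * (?X * pderiv (?W (Suc m))) + of_nat (Suc (Suc m)) * (?X * ?W (Suc (Suc m)))"
          unfolding B2 by (simp only: algebra_simps)
        also have "\<dots> = of_nat n * ?W (Suc n) + 2 * ?R * pderiv (?W n)"
          unfolding C1 B1 A ofn of_nat_Suc by algebra
        finally show ?thesis .
      qed
    qed
    have "pderiv (?W (Suc (Suc n))) = ?R * pderiv (?W n) + of_nat (Suc n) * ?W (Suc n)"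
      unfolding step C of_nat_Suc by algebra
    with C show ?case by blast
  qed
  then show "pderiv (?W (Suc (Suc n))) = ?R * pderiv (?W n) + of_nat (Suc n) * ?W (Suc n)"
    and "?X * pderiv (?W (Suc n)) = of_nat n * ?W (Suc n) + 2 * ?R * pderiv (?W n)"
    by blast+
qed

lemma higher_pderiv_lucas_poly:
  fixes r :: "'a::idom"
  shows "(pderiv ^^ Suc k) (lucas_poly r (Suc (Suc n))) =
           [:r:] * (pderiv ^^ Suc k) (lucas_poly r n) +
           of_nat (Suc n) * (pderiv ^^ k) (lucas_poly r (Suc n))"
    and "[:0, 1:] * (pderiv ^^ Suc k) (lucas_poly r (Suc n)) =
           (of_nat n - of_nat k) * (pderiv ^^ k) (lucas_poly r (Suc n)) +
           2 * [:r:] * (pderiv ^^ Suc k) (lucas_poly r n)"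
proof -
  show "(pderiv ^^ Suc k) (lucas_poly r (Suc (Suc n))) =
           [:r:] * (pderiv ^^ Suc k) (lucas_poly r n) +
           of_nat (Suc n) * (pderiv ^^ k) (lucas_poly r (Suc n))"
  proof (induction k)
    case 0
    then show ?case using pderiv_lucas_poly(1)[of r n] by simp
  next
    case (Suc k)
    have "(pderiv ^^ Suc (Suc k)) (lucas_poly r (Suc (Suc n))) =
      pderiv ((pderiv ^^ Suc k) (lucas_poly r (Suc (Suc n))))" by simp
    also have "\<dots> = [:r:] * (pderiv ^^ Suc (Suc k)) (lucas_poly r n) +
           of_nat (Suc n) * (pderiv ^^ Suc k) (lucas_poly r (Suc n))"
      unfolding Suc by (simp only: pderiv_add pderiv_const_mult funpow.simps o_apply)
    finally show ?case .
  qed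
  show "[:0, 1:] * (pderiv ^^ Suc k) (lucas_poly r (Suc n)) =
           (of_nat n - of_nat k) * (pderiv ^^ k) (lucas_poly r (Suc n)) +
           2 * [:r:] * (pderiv ^^ Suc k) (lucas_poly r n)"
  proof (induction k)
    case 0
    then show ?case using pderiv_lucas_poly(2)[of r n] by simp
  next
    case (Suc k)
    let ?D = "\<lambda>k. (pderiv ^^ k) (lucas_poly r (Suc n))" and ?E = "\<lambda>k. (pderiv ^^ k) (lucas_poly r n)"
    have E: "pderiv (?D j) = ?D (Suc j)" "pderiv (?E j) = ?E (Suc j)" for j by simp_all
    have "pderiv ([:0, 1:] * ?D (Suc k)) =
          pderiv ((of_nat n - of_nat k) * ?D k + of_nat 2 * ([:r:] * ?E (Suc k)))"
      unfolding Suc by simp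
    then have "?D (Suc k) + [:0, 1:] * ?D (Suc (Suc k)) =
          of_nat n * ?D (Suc k) - of_nat k * ?D (Suc k) + of_nat 2 * ([:r:] * ?E (Suc (Suc k)))"
      by (simp only: pderiv_add pderiv_diff pderiv_X_mult pderiv_const_mult left_diff_distrib E)
    then show ?case unfolding of_nat_Suc of_nat_numeral by algebra
  qed
qed

text \<open>
  For \<open>k = 0\<close> this is Chebyshev's differential equation, rescaled; the general case is its \<open>k\<close>-th
  derivative. A direct differentiation would leave a term \<open>2 k X W\<^sup>(\<^sup>k\<^sup>+\<^sup>1\<^sup>)\<close>. It is traded for a term in
  \<open>W\<^sub>n\<close>, of lower index, because multiplication by \<open>X\<close> has no sign under the functional used later,
  whereas the remaining coefficients are scalars.
\<close>

lemma higher_pderiv_lucas_poly_ode: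
  fixes r :: "'a::idom"
  shows "([:0, 1:]\<^sup>2 - 4 * [:r:]) * (pderiv ^^ Suc (Suc k)) (lucas_poly r (Suc n)) +
           3 * ([:0, 1:] * (pderiv ^^ Suc k) (lucas_poly r (Suc n))) =
         (of_nat n - of_nat k) * (of_nat n - of_nat k + 2) * (pderiv ^^ k) (lucas_poly r (Suc n)) -
           4 * of_nat k * [:r:] * (pderiv ^^ Suc k) (lucas_poly r n)"
proof (cases n)
  case 0
  have "(pderiv ^^ Suc i) (1 :: 'a poly) = 0" for i
    by (induction i) simp_all
  then show ?thesis using 0 by (cases k) (simp_all del: funpow.simps add: funpow_0)
next
  case (Suc m)
  let ?X = "[:0, 1:] :: 'a poly" and ?R = "[:r:] :: 'a poly"
  let ?D = "\<lambda>k n. (pderiv ^^ k) (lucas_poly r n)"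
  have B: "?D (Suc (Suc k)) (Suc n) = ?R * ?D (Suc (Suc k)) m + (of_nat m + 1) * ?D (Suc k) n"
    using higher_pderiv_lucas_poly(1)[of "Suc k" r m] Suc by (simp only: of_nat_Suc add.commute)
  have C1: "?X * ?D (Suc k) (Suc n) = (of_nat m + 1 - of_nat k) * ?D k (Suc n) + 2 * ?R * ?D (Suc k) n"
    using higher_pderiv_lucas_poly(2)[of k r n] Suc by (simp only: of_nat_Suc add.commute)
  have C2: "?X * ?D (Suc (Suc k)) (Suc n) = (of_nat m - of_nat k) * ?D (Suc k) (Suc n) + 2 * ?R * ?D (Suc (Suc k)) n"
    using higher_pderiv_lucas_poly(2)[of "Suc k" r n] Suc by (simp only: of_nat_Suc add.commute add_diff_cancel_left add_diff_cancel_right)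
  have C3: "?X * ?D (Suc (Suc k)) n = (of_nat m - of_nat k - 1) * ?D (Suc k) n + 2 * ?R * ?D (Suc (Suc k)) m"
    using higher_pderiv_lucas_poly(2)[of "Suc k" r m] Suc by (simp only: of_nat_Suc diff_diff_eq add.commute)
  have n: "of_nat n = (of_nat m + 1 :: 'a poly)" using Suc by simp
  show ?thesis unfolding n using B C1 C2 C3 by algebra
qed

section \<open>The moment functional\<close>

text \<open>
  With \<open>S = s\<^sup>2\<close>, these are the moments of the normalised weight
  \<open>(s - X)\<^sup>1\<^sup>/\<^sup>2\<^sup>+\<^sup>u (s + X)\<^sup>1\<^sup>/\<^sup>2\<^sup>-\<^sup>u\<close> on \<open>[-s, s]\<close> with \<open>u = - w / (2 s)\<close>, continued to all complex \<open>w\<close>.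
  The recurrence is integration by parts on monomials.
\<close>

fun moment :: "complex \<Rightarrow> complex \<Rightarrow> nat \<Rightarrow> complex" where
  "moment w S 0 = 1"
| "moment w S (Suc 0) = w / 3"
| "moment w S (Suc (Suc j)) = (w * moment w S (Suc j) + S * of_nat (Suc j) * moment w S j) / of_nat (j + 4)"

definition moment_functional :: "complex \<Rightarrow> complex \<Rightarrow> complex poly \<Rightarrow> complex" where
  "moment_functional w S p = (\<Sum>i\<le>degree p. coeff p i * moment w S i)"

lemma moment_functional_altdef:
  "degree p \<le> N \<Longrightarrow> moment_functional w S p = (\<Sum>i\<le>N. coeff p i * moment w S i)"
  unfolding moment_functional_def
  by (rule sum.mono_neutral_left) (auto simp: coeff_eq_0)

lemma moment_functional_add:
  "moment_functional w S (p + q) = moment_functional w S p + moment_functional w S q"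
proof -
  let ?N = "max (degree p) (degree q)"
  have "degree (p + q) \<le> ?N" by (rule degree_add_le_max)
  then show ?thesis
    by (simp add: moment_functional_altdef[of _ ?N] sum.distrib algebra_simps)
qed

lemma moment_functional_smult:
  "moment_functional w S (smult c p) = c * moment_functional w S p"
  by (simp add: moment_functional_altdef[of _ "degree p"] sum_distrib_left mult.assoc)

lemma moment_functional_const_mult:
  "moment_functional w S ([:c:] * p) = c * moment_functional w S p"
  by (simp add: moment_functional_smult)

lemma moment_functional_diff:
  "moment_functional w S (p - q) = moment_functional w S p - moment_functional w S q"
  using moment_functional_add[of w S p "- q"] moment_functional_smult[of w S "- 1" q] by simp

lemma moment_functional_0 [simp]: "moment_functional w S 0 = 0"
  by (simp add: moment_functional_def)

lemma moment_functional_1 [simp]: "moment_functional w S 1 = 1"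
  by (simp add: moment_functional_def)

lemma moment_functional_monom: "moment_functional w S (monom c n) = c * moment w S n"
proof (cases "c = 0")
  case False
  then show ?thesis
    by (simp add: moment_functional_def degree_monom_eq sum.delta' if_distrib[of "\<lambda>x. x * _"] cong: if_cong)
qed simp

text \<open>
  For the weight, this says that the derivative of \<open>X\<^sup>2 - S\<close> times \<open>p\<close> times the weight integrates to
  \<open>0\<close> over \<open>[-s, s]\<close>, as the boundary terms vanish. For general \<open>w\<close> it is the recurrence of the moments.
\<close>

lemma moment_functional_by_parts:
  "moment_functional w S (([:0, 1:]\<^sup>2 - [:S:]) * pderiv p + 3 * ([:0, 1:] * p)) =
     w * moment_functional w S p"
proof -
  let ?T = "moment_functional w S"
  let ?D = "\<lambda>p. ([:0, 1:]\<^sup>2 - [:S:]) * pderiv p + 3 * ([:0, 1:] * p)"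
  have mon: "?T (?D (monom c j)) = w * ?T (monom c j)" for c j
  proof (cases j)
    case 0
    have "?D (monom c j) = monom (3 * c) 1"
      using 0 by (simp add: monom_altdef numeral_poly)
    then show ?thesis using 0 by (simp add: moment_functional_monom)
  next
    case (Suc i)
    have "?D (monom c j) = monom (of_nat (i + 4) * c) (Suc (Suc i)) - monom (S * of_nat (Suc i) * c) i"
    proof -
      have X: "[:0, 1:] = monom (1 :: complex) (Suc 0)" "[:S:] = monom S 0" "3 = monom (3 :: complex) 0"
        by (simp_all add: monom_altdef monom_0 numeral_poly)
      show ?thesis
        unfolding Suc pderiv_monom X power2_eq_square mult_monom left_diff_distrib
        by (simp add: add_monom diff_monom algebra_simps)
    qed
    moreover have "of_nat (i + 4) * moment w S (Suc (Suc i)) =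
                     w * moment w S (Suc i) + S * of_nat (Suc i) * moment w S i"
      by (simp add: field_simps del: of_nat_Suc of_nat_add)
    ultimately have "?T (?D (monom c j)) =
        c * (w * moment w S (Suc i) + S * of_nat (Suc i) * moment w S i) - S * of_nat (Suc i) * c * moment w S i"
      by (simp only: moment_functional_monom moment_functional_diff mult.commute[of _ c] mult.assoc)
    then show ?thesis
      unfolding Suc moment_functional_monom by (simp add: algebra_simps)
  qed
  have D_add: "?D (p + q) = ?D p + ?D q" for p q
    by (simp add: pderiv_add algebra_simps)
  have add: "?T (?D (p + q)) = ?T (?D p) + ?T (?D q)" for p q
    unfolding D_add by (rule moment_functional_add)
  have "?T (?D (\<Sum>i\<le>n. monom (coeff p i) i)) = w * ?T (\<Sum>i\<le>n. monom (coeff p i) i)" for n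
  proof (induction n)
    case 0
    then show ?case using mon by simp
  next
    case (Suc n)
    show ?case
      unfolding sum.atMost_Suc add Suc mon
      by (simp add: moment_functional_add distrib_left)
  qed
  from this[of "degree p"] show ?thesis by (simp only: poly_as_sum_of_monoms)
qed


section \<open>Nonvanishing off the line\<close>

text \<open>
  The sign of \<open>Re w\<close> enters \<open>b\<close> and \<open>c\<close> in the proof as a common factor, which treats both half-planes
  at once: the recurrences for \<open>b\<close> and \<open>c\<close> are linear with nonnegative coefficients, and \<open>w\<close> occurs
  only in the term that becomes \<open>\<bar>Re w\<bar>\<close>. The hypothesis \<open>\<delta> \<ge> 0\<close> says that the zeros of the Lucas
  polynomials, which fill \<open>[-2 \<surd>\<rho>, 2 \<surd>\<rho>]\<close>, stay within the support \<open>[-s, s]\<close> of the functional.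
\<close>

lemma moment_functional_lucas_poly_nonzero:
  fixes w :: complex and \<rho> \<delta> :: real
  assumes w: "Re w \<noteq> 0" and \<rho>: "\<rho> \<ge> 0" and \<delta>: "\<delta> \<ge> 0"
  shows "moment_functional w (of_real (4 * \<rho> + \<delta>)) (lucas_poly (of_real \<rho>) (Suc n)) \<noteq> 0"
proof -
  define S :: complex where "S = of_real (4 * \<rho> + \<delta>)"
  define G where "G k n = moment_functional w S ((pderiv ^^ k) (lucas_poly (of_real \<rho>) n))" for k n
  have of_nat_mult: "(of_nat m :: complex poly) * p = [:of_nat m:] * p" for m p
    by (simp add: of_nat_poly)
  have G_rec: "G (Suc k) (Suc (Suc n)) = of_real \<rho> * G (Suc k) n + of_nat (Suc n) * G k (Suc n)" for k n
    unfolding G_def higher_pderiv_lucas_poly of_nat_mult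
    by (simp only: moment_functional_add moment_functional_const_mult)
  have G_step: "(of_nat n - of_nat k) * (of_nat n - of_nat k + 2) * G k (Suc n) =
                  w * G (Suc k) (Suc n) + of_real \<delta> * G (Suc (Suc k)) (Suc n) +
                  4 * of_nat k * of_real \<rho> * G (Suc k) n" for k n
  proof -
    let ?D = "\<lambda>k n. (pderiv ^^ k) (lucas_poly (of_real \<rho> :: complex) n)"
    have S: "[:S:] = 4 * [:of_real \<rho>:] + [:of_real \<delta>:]"
      by (simp add: S_def numeral_poly)
    have "([:0, 1:]\<^sup>2 - [:S:]) * pderiv (?D (Suc k) (Suc n)) + 3 * ([:0, 1:] * ?D (Suc k) (Suc n)) =
          (of_nat n - of_nat k) * (of_nat n - of_nat k + 2) * ?D k (Suc n) -
          4 * of_nat k * [:of_real \<rho>:] * ?D (Suc k) n - [:of_real \<delta>:] * ?D (Suc (Suc k)) (Suc n)"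
      using higher_pderiv_lucas_poly_ode[where r = "of_real \<rho> :: complex" and k = k and n = n]
      unfolding S funpow.simps o_apply
      by algebra
    also have "\<dots> = [:(of_nat n - of_nat k) * (of_nat n - of_nat k + 2):] * ?D k (Suc n) -
          [:4 * of_nat k * of_real \<rho>:] * ?D (Suc k) n - [:of_real \<delta>:] * ?D (Suc (Suc k)) (Suc n)"
    proof -
      have "(of_nat n - of_nat k) * (of_nat n - of_nat k + 2) =
              [:(of_nat n - of_nat k) * (of_nat n - of_nat k + 2) :: complex:]"
        and "4 * of_nat k * [:of_real \<rho>:] = [:4 * of_nat k * of_real \<rho> :: complex:]"
        by (simp_all add: of_nat_poly numeral_poly)
      then show ?thesis by (simp only:)
    qed
    finally have "w * G (Suc k) (Suc n) = moment_functional w S \<dots>"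
      unfolding G_def moment_functional_by_parts[symmetric] by (rule arg_cong)
    then show ?thesis
      unfolding moment_functional_diff moment_functional_const_mult G_def by (simp add: algebra_simps)
  qed
  have G_0: "G k m = 0" if "m \<le> k" for k m
    using that
  proof (induction m arbitrary: k rule: less_induct)
    case (less m)
    consider "m = 0" | "m = Suc 0" | i where "m = Suc (Suc i)" by (metis not0_implies_Suc)
    then show ?case
    proof cases
      case 1
      then show ?thesis by (simp add: G_def)
    next
      case 2
      have "(pderiv ^^ Suc i) (1 :: complex poly) = 0" for i
        by (induction i) simp_all
      then show ?thesis using 2 less.prems by (cases k) (simp_all add: G_def del: funpow.simps)
    next
      case (3 i)
      then obtain j where "k = Suc j" using less.prems by (cases k) auto
      then show ?thesis using less.IH[of i k] less.IH[of "Suc i" j] less.prems 3 by (simp add: G_rec)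
    qed
  qed
  have G_top: "G m (Suc m) = fact m" for m
  proof (induction m)
    case 0
    then show ?case by (simp add: G_def)
  next
    case (Suc m)
    then show ?case by (simp add: G_rec G_0)
  qed
  let ?\<epsilon> = "sgn (Re w)"
  define b where "b k n = ?\<epsilon> * Re (G (Suc k) (Suc n) * cnj (G (Suc k) n))" for k n
  define c where "c k n = ?\<epsilon> * Re (G k (Suc n) * cnj (G (Suc k) (Suc n)))" for k n
  have b_rec: "b k (Suc n) = \<rho> * b k n + real (Suc n) * c k n" for k n
    unfolding b_def c_def G_rec by (simp add: algebra_simps)
  have c_rec: "(real n - real k) * (real n - real k + 2) * c k n =
                 \<bar>Re w\<bar> * (cmod (G (Suc k) (Suc n)))\<^sup>2 + \<delta> * c (Suc k) n + 4 * real k * \<rho> * b k n" for k n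
  proof -
    let ?g = "G (Suc k) (Suc n)"
    have "of_real ((real n - real k) * (real n - real k + 2)) * (G k (Suc n) * cnj ?g) =
          w * (?g * cnj ?g) + of_real \<delta> * (G (Suc (Suc k)) (Suc n) * cnj ?g) + of_real (4 * real k * \<rho>) * (G (Suc k) n * cnj ?g)"
      using G_step[of n k]
      by (simp only: of_real_mult of_real_diff of_real_add of_real_of_nat_eq of_real_numeral) algebra
    from arg_cong[OF this, of "\<lambda>z. ?\<epsilon> * Re z"] show ?thesis
      unfolding complex_norm_square[symmetric] b_def c_def
      by (simp add: algebra_simps abs_sgn)
  qed
  have c_nonneg: "c k n \<ge> 0" if b: "\<And>k. b k n \<ge> 0" for k n
  proof (induction "n - k" arbitrary: k)
    case 0
    then show ?case by (simp add: c_def G_0)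
  next
    case (Suc d)
    then have "k < n" and "c (Suc k) n \<ge> 0" by simp_all
    then have "(real n - real k) * (real n - real k + 2) * c k n \<ge> 0"
      unfolding c_rec using b[of k] \<rho> \<delta> by simp
    moreover have "(real n - real k) * (real n - real k + 2) > 0"
      using \<open>k < n\<close> by (intro mult_pos_pos) simp_all
    ultimately show ?case by (smt (verit) mult_pos_neg)
  qed
  have b_nonneg: "b k n \<ge> 0" for k n
  proof (induction n arbitrary: k)
    case 0
    then show ?case by (simp add: b_def G_0)
  next
    case (Suc n)
    then show ?case unfolding b_rec using c_nonneg[of n k] \<rho> by simp
  qed
  (* Where c vanishes, so do all the nonnegative terms that add up to a multiple of it. *)
  have descend: "G (Suc k) (Suc n) = 0" if "G k (Suc n) = 0" for k
  proof -
    have "c k n = 0" using that by (simp add: c_def)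
    then have "\<bar>Re w\<bar> * (cmod (G (Suc k) (Suc n)))\<^sup>2 + (\<delta> * c (Suc k) n + 4 * real k * \<rho> * b k n) = 0"
      using c_rec[of n k] by simp
    moreover have "\<delta> * c (Suc k) n + 4 * real k * \<rho> * b k n \<ge> 0"
      using c_nonneg[of n] b_nonneg \<rho> \<delta> by simp
    ultimately have "\<bar>Re w\<bar> * (cmod (G (Suc k) (Suc n)))\<^sup>2 = 0"
      by (smt (verit) mult_nonneg_nonneg abs_ge_zero zero_le_power2)
    then show ?thesis using w by simp
  qed
  have "G 0 (Suc n) \<noteq> 0"
  proof
    assume "G 0 (Suc n) = 0"
    then have "G k (Suc n) = 0" for k
      by (induction k) (simp_all add: descend)
    with G_top[of n] show False by simp
  qed
  then show ?thesis by (simp add: G_def S_def)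
qed

section \<open>The coefficients of the generating function\<close>

text \<open>
  The polynomial \<open>W\<^sub>n\<^sub>+\<^sub>3 - r W\<^sub>n\<^sub>+\<^sub>1\<close> is an antiderivative of \<open>(n + 2) W\<^sub>n\<^sub>+\<^sub>2\<close>, so that integration
  by parts applied to it relates values at Lucas polynomials only.
\<close>

lemma moment_functional_lucas_poly_rec:
  fixes w S r :: complex
  defines "t \<equiv> \<lambda>n. moment_functional w S (lucas_poly r n)"
  shows "of_nat (n + 5) * t (n + 4) =
           w * (t (n + 3) - r * t (n + 1)) + (S - 2 * r) * of_nat (n + 2) * t (n + 2)
           - r\<^sup>2 * (of_nat n - 1) * t n"
proof -
  let ?W = "lucas_poly r" and ?X = "[:0, 1:] :: complex poly" and ?R = "[:r:]" and ?S = "[:S:]"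
  have E: "n + 1 = Suc n" "n + 2 = Suc (Suc n)" "n + 3 = Suc (Suc (Suc n))"
    "n + 4 = Suc (Suc (Suc (Suc n)))" by simp_all
  have W: "?W (n + 2) = ?X * ?W (n + 1) - ?R * ?W n"
    "?W (n + 3) = ?X * ?W (n + 2) - ?R * ?W (n + 1)"
    "?W (n + 4) = ?X * ?W (n + 3) - ?R * ?W (n + 2)"
    unfolding E by (rule lucas_poly.simps)+
  have D: "pderiv (?W (n + 3)) = ?R * pderiv (?W (n + 1)) + (of_nat n + 2) * ?W (n + 2)"
    using pderiv_lucas_poly(1)[of r "n + 1"] by (simp add: eval_nat_numeral)
  let ?p = "?W (n + 3) - ?R * ?W (n + 1)"
  have "(?X\<^sup>2 - ?S) * pderiv ?p + 3 * (?X * ?p) =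
          (of_nat n + 5) * ?W (n + 4) - (?S - 2 * ?R) * (of_nat n + 2) * ?W (n + 2)
            + ?R\<^sup>2 * (of_nat n - 1) * ?W n"
    unfolding pderiv_diff pderiv_const_mult using D W by algebra
  also have "\<dots> = [:of_nat n + 5:] * ?W (n + 4) - [:(S - 2 * r) * (of_nat n + 2):] * ?W (n + 2)
            + [:r\<^sup>2 * (of_nat n - 1):] * ?W n"
    by (simp add: of_nat_poly numeral_poly power2_eq_square algebra_simps)
  finally have "w * moment_functional w S ?p = moment_functional w S \<dots>"
    unfolding moment_functional_by_parts[symmetric] by (rule arg_cong)
  then show ?thesis
    unfolding moment_functional_diff moment_functional_add moment_functional_const_mult t_def
    by (simp add: algebra_simps)
qed

text \<open>
  Both sides satisfy the same recurrence, but the formula fails at the start of \<open>h\<close>: for \<open>h 1\<close> it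
  would give \<open>0\<close>, and \<open>h 2\<close> exceeds its prediction by \<open>r * h 0\<close>. These deviations do not propagate: in
  the recurrence for \<open>h 5\<close> the contributions of \<open>h 1\<close> and of the excess of \<open>h 2\<close> cancel, and in the one
  for \<open>h 6\<close> the factor \<open>n - 5\<close> of \<open>h 2\<close> is zero.
\<close>

lemma moment_functional_solves_rec:
  fixes h :: "nat \<Rightarrow> complex" and w S r :: complex
  assumes h: "\<And>n. of_nat (Suc n) * h (Suc n) =
    w * (h n - (if n < 2 then 0 else r * h (n - 2)))
    + (S - 2 * r) * (of_nat n - 2) * (if n < 1 then 0 else h (n - 1))
    - r\<^sup>2 * (of_nat n - 5) * (if n < 3 then 0 else h (n - 3))"
  shows "h (n + 3) = h 0 * (w\<^sup>2 - S) / 2 * moment_functional w S (lucas_poly r (n + 2))"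
proof -
  define K where "K = h 0 * (w\<^sup>2 - S) / 2"
  define t where "t n = K * moment_functional w S (lucas_poly r n)" for n
  have K: "2 * K = h 0 * (w\<^sup>2 - S)" by (simp add: K_def)
  have h1: "h 1 = w * h 0" using h[of 0] by simp
  have "2 * h 2 = w * h 1 - (S - 2 * r) * h 0"
    using h[of 1] by (simp add: numeral_2_eq_2 algebra_simps)
  then have "2 * h 2 = 2 * (K + r * h 0)" using K h1 by algebra
  then have h2: "h 2 = K + r * h 0" by (metis mult_left_cancel zero_neq_numeral)
  have "3 * h 3 = w * (h 2 - r * h 0)"
    using h[of 2] by (simp add: eval_nat_numeral)
  then have h3: "3 * h 3 = w * K" using h2 by algebra
  have "4 * h 4 = w * (h 3 - r * h 1) + (S - 2 * r) * h 2 + 2 * r\<^sup>2 * h 0"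
    using h[of 3] by (simp add: eval_nat_numeral)
  then have h4: "12 * h 4 = K * (w\<^sup>2 + 3 * S - 12 * r)" using h1 h2 h3 K by algebra
  have t0: "t 0 = 0" "t 1 = K" by (simp_all add: t_def)
  have X: "lucas_poly r 2 = monom 1 1" "lucas_poly r 3 = monom 1 2 - monom r 0"
    by (simp_all add: eval_nat_numeral monom_altdef monom_0)
  have t2: "3 * t 2 = w * K" and t3: "12 * t 3 = K * (w\<^sup>2 + 3 * S - 12 * r)"
    unfolding t_def X moment_functional_diff moment_functional_monom
    by (simp_all add: eval_nat_numeral field_simps)
  have h34: "h 3 = t 2" "h 4 = t 3"
    using h3 h4 t2 t3 by (metis mult_left_cancel zero_neq_numeral)+
  have t_rec: "of_nat (n + 5) * t (n + 4) =
           w * (t (n + 3) - r * t (n + 1)) + (S - 2 * r) * of_nat (n + 2) * t (n + 2)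
           - r\<^sup>2 * (of_nat n - 1) * t n" for n
    using moment_functional_lucas_poly_rec[of n w S r] unfolding t_def
    by (simp only: algebra_simps) algebra
  have h_rec: "of_nat (n + 5) * h (n + 5) =
           w * (h (n + 4) - r * h (n + 2)) + (S - 2 * r) * of_nat (n + 2) * h (n + 3)
           - r\<^sup>2 * (of_nat n - 1) * h (n + 1)" for n
    using h[of "n + 4"] by (simp add: eval_nat_numeral algebra_simps)
  have "h (n + 3) = t (n + 2)" for n
  proof (induction n rule: less_induct)
    case (less n)
    consider "n = 0" | "n = 1" | "n = 2" | m where "n = m + 3"
      by (metis One_nat_def Suc_1 add.commute le_Suc_ex less_Suc_eq linorder_not_less
          not_less_zero numeral_3_eq_3)
    then show ?case
    proof cases
      case 1
      then show ?thesis using h34 by (simp add: eval_nat_numeral)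
    next
      case 2
      then show ?thesis using h34 by (simp add: eval_nat_numeral)
    next
      case 3
      have "5 * h 5 = w * (h 4 - r * h 2) + (S - 2 * r) * 2 * h 3 + r\<^sup>2 * h 1"
        and "5 * t 4 = w * (t 3 - r * t 1) + (S - 2 * r) * 2 * t 2 + r\<^sup>2 * t 0"
        using h_rec[of 0] t_rec[of 0] by (simp_all add: numeral_2_eq_2)
      moreover have "w * (h 4 - r * h 2) + (S - 2 * r) * 2 * h 3 + r\<^sup>2 * h 1 =
          w * (t 3 - r * t 1) + (S - 2 * r) * 2 * t 2 + r\<^sup>2 * t 0"
        unfolding h34 h1 h2 t0 by (simp add: power2_eq_square algebra_simps)
      ultimately have "5 * h 5 = 5 * t 4" by (simp only:)
      then show ?thesis using 3 by simp
    next
      case (4 m)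
      have IH: "h (m + 5) = t (m + 4)" "h (m + 4) = t (m + 3)" "h (m + 3) = t (m + 2)"
        using less.IH[of "m + 2"] less.IH[of "m + 1"] less.IH[of m] 4 by (simp_all add: eval_nat_numeral)
      have idx: "m + 1 + 5 = m + 6" "m + 1 + 4 = m + 5" "m + 1 + 3 = m + 4"
        "m + 1 + 2 = m + 3" "m + 1 + 1 = m + 2" "of_nat (m + 1) - 1 = (of_nat m :: complex)" by simp_all
      have "of_nat m * h (m + 2) = of_nat m * t (m + 1)"
        using less.IH[of "m - 1"] 4 by (cases m) (simp_all add: eval_nat_numeral)
      moreover have "of_nat (m + 6) * h (m + 6) =
           w * (h (m + 5) - r * h (m + 3)) + (S - 2 * r) * of_nat (m + 3) * h (m + 4)
           - r\<^sup>2 * (of_nat m * h (m + 2))"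
        using h_rec[of "m + 1"] unfolding idx by (simp only: mult.assoc)
      moreover have "of_nat (m + 6) * t (m + 5) =
           w * (t (m + 4) - r * t (m + 2)) + (S - 2 * r) * of_nat (m + 3) * t (m + 3)
           - r\<^sup>2 * (of_nat m * t (m + 1))"
        using t_rec[of "m + 1"] unfolding idx by (simp only: mult.assoc)
      ultimately have "of_nat (m + 6) * h (m + 6) = of_nat (m + 6) * t (m + 5)"
        by (simp only: IH)
      moreover have "of_nat (m + 6) \<noteq> (0 :: complex)"
        by (simp only: of_nat_eq_0_iff)
      ultimately have "h (m + 6) = t (m + 5)"
        using mult_left_cancel by blast
      then show ?thesis using 4 by (simp add: eval_nat_numeral)
    qed
  qed
  then show ?thesis by (simp add: t_def K_def)
qed

text \<open>
  This is the logarithmic derivative \<open>x Q'(z) / Q(z) - (1 - x) Q'(-z) / Q(-z)\<close>, cleared of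
  denominators. With \<open>p = z1 z2\<close> and \<open>e = z1 + z2\<close>, the polynomial on the left is \<open>Q(z) Q(-z)\<close>.
\<close>

lemma gen_fun_ode:
  fixes z1 z2 :: real and x :: complex
  assumes "0 < z1" "0 < z2"
  defines "p \<equiv> of_real (z1 * z2)" and "e \<equiv> of_real (z1 + z2)"
  shows "eventually (\<lambda>z. deriv (gen_fun z1 z2 x) z * (p\<^sup>2 - (e\<^sup>2 - 2 * p) * z ^ 2 + z ^ 4) =
           (2 * z ^ 3 - (e\<^sup>2 - 2 * p) * z + (1 - 2 * x) * e * (p - z ^ 2)) * gen_fun z1 z2 x z) (nhds 0)"
proof -
  have Q: "Q z1 z2 z = p - e * z + z\<^sup>2" for z
    by (simp add: Q_def p_def e_def power2_eq_square algebra_simps)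
  have "Q z1 z2 0 \<notin> \<real>\<^sub>\<le>\<^sub>0"
    using mult_pos_pos[OF assms(1,2)] by (simp add: Q_def complex_nonpos_Reals_iff not_le)
  have ev: "eventually (\<lambda>z. Q z1 z2 (c * z) \<notin> \<real>\<^sub>\<le>\<^sub>0) (nhds 0)" for c
  proof -
    have "open ((\<lambda>z. Q z1 z2 (c * z)) -` (- \<real>\<^sub>\<le>\<^sub>0))"
      unfolding Q_def by (intro open_vimage continuous_intros) auto
    from eventually_nhds_in_open[OF this, of 0] show ?thesis
      using \<open>Q z1 z2 0 \<notin> \<real>\<^sub>\<le>\<^sub>0\<close> by simp
  qed
  show ?thesis
    using ev[of 1] ev[of "- 1"]
  proof eventually_elim
    case (elim z)
    let ?A = "Q z1 z2 z" and ?B = "Q z1 z2 (- z)"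
    have AB: "?A \<notin> \<real>\<^sub>\<le>\<^sub>0" "?B \<notin> \<real>\<^sub>\<le>\<^sub>0" using elim by simp_all
    then have nz: "?A \<noteq> 0" "?B \<noteq> 0" by auto
    have dA: "(Q z1 z2 has_field_derivative (2 * z - e)) (at z)"
      unfolding Q[abs_def] by (auto intro!: derivative_eq_intros)
    have dB: "((\<lambda>z. Q z1 z2 (- z)) has_field_derivative (2 * z + e)) (at z)"
      unfolding Q by (auto intro!: derivative_eq_intros)
    have "(gen_fun z1 z2 x has_field_derivative
            (x * ?A powr (x - 1) * (2 * z - e)) * ?B powr (1 - x) +
            ((1 - x) * ?B powr (1 - x - 1) * (2 * z + e)) * ?A powr x) (at z)"
      unfolding gen_fun_def[abs_def]
      by (rule DERIV_mult[OF DERIV_chain2[OF has_field_derivative_powr[OF AB(1)] dA]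
                             DERIV_chain2[OF has_field_derivative_powr[OF AB(2)] dB]])
    moreover have "?A powr (x - 1) = ?A powr x / ?A" "?B powr (1 - x - 1) = ?B powr (1 - x) / ?B"
      using nz powr_diff[of ?A x 1] powr_diff[of ?B "1 - x" 1] by simp_all
    ultimately have "deriv (gen_fun z1 z2 x) z =
       (x * (?A powr x / ?A) * (2 * z - e)) * ?B powr (1 - x) +
       ((1 - x) * (?B powr (1 - x) / ?B) * (2 * z + e)) * ?A powr x"
      by (metis DERIV_imp_deriv)
    then have "deriv (gen_fun z1 z2 x) z * (?A * ?B) =
       (x * (2 * z - e) * ?B + (1 - x) * (2 * z + e) * ?A) * gen_fun z1 z2 x z"
      unfolding gen_fun_def using nz by (simp add: divide_simps) (simp only: algebra_simps)
    then show ?case unfolding Q by algebra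
  qed
qed

lemma gen_fun_coeff_rec:
  fixes z1 z2 :: real and x :: complex and h :: "nat \<Rightarrow> complex"
  assumes z: "0 < z1" "0 < z2"
    and h: "gen_fun z1 z2 x has_fps_expansion Abs_fps h"
  defines "w \<equiv> (1 - 2 * x) * of_real (1 / z1 + 1 / z2)"
    and "S \<equiv> of_real ((1 / z1 + 1 / z2)\<^sup>2)" and "r \<equiv> of_real (1 / (z1 * z2))"
  shows "of_nat (Suc n) * h (Suc n) =
    w * (h n - (if n < 2 then 0 else r * h (n - 2)))
    + (S - 2 * r) * (of_nat n - 2) * (if n < 1 then 0 else h (n - 1))
    - r\<^sup>2 * (of_nat n - 5) * (if n < 3 then 0 else h (n - 3))"
proof -
  define p e :: complex where "p = of_real (z1 * z2)" and "e = of_real (z1 + z2)"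
  let ?F = "Abs_fps h" and ?X = "fps_X :: complex fps" and ?c = fps_const
  have "(\<lambda>z. deriv (gen_fun z1 z2 x) z * (p\<^sup>2 - (e\<^sup>2 - 2 * p) * z ^ 2 + z ^ 4)) has_fps_expansion
          fps_deriv ?F * (?c (p\<^sup>2) - ?c (e\<^sup>2 - 2 * p) * ?X ^ 2 + ?X ^ 4)"
    by (intro fps_expansion_intros h)
  moreover have "(\<lambda>z. (2 * z ^ 3 - (e\<^sup>2 - 2 * p) * z + (1 - 2 * x) * e * (p - z ^ 2)) * gen_fun z1 z2 x z)
      has_fps_expansion
      (2 * ?X ^ 3 - ?c (e\<^sup>2 - 2 * p) * ?X + ?c ((1 - 2 * x) * e) * (?c p - ?X ^ 2)) * ?F"
    by (intro fps_expansion_intros h)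
  moreover note has_fps_expansion_cong[OF gen_fun_ode[OF z, of x] refl]
  ultimately have "fps_deriv ?F * (?c (p\<^sup>2) - ?c (e\<^sup>2 - 2 * p) * ?X ^ 2 + ?X ^ 4) =
      (2 * ?X ^ 3 - ?c (e\<^sup>2 - 2 * p) * ?X + ?c ((1 - 2 * x) * e) * (?c p - ?X ^ 2)) * ?F"
    unfolding p_def e_def by (simp only: fps_expansion_unique_complex)
  then have "?c (p\<^sup>2) * fps_deriv ?F - ?c (e\<^sup>2 - 2 * p) * (?X ^ 2 * fps_deriv ?F) + ?X ^ 4 * fps_deriv ?F =
      ?c 2 * (?X ^ 3 * ?F) - ?c (e\<^sup>2 - 2 * p) * (?X ^ 1 * ?F)
      + ?c ((1 - 2 * x) * e) * (?c p * ?F - ?X ^ 2 * ?F)"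
    by (simp add: algebra_simps numeral_fps_const)
  from arg_cong[OF this, of "\<lambda>f. fps_nth f n"]
  have rec: "p\<^sup>2 * (of_nat (Suc n) * h (Suc n))
      - (e\<^sup>2 - 2 * p) * (if n < 2 then 0 else of_nat (Suc (n - 2)) * h (Suc (n - 2)))
      + (if n < 4 then 0 else of_nat (Suc (n - 4)) * h (Suc (n - 4))) =
      2 * (if n < 3 then 0 else h (n - 3)) - (e\<^sup>2 - 2 * p) * (if n < 1 then 0 else h (n - 1))
      + (1 - 2 * x) * e * (p * h n - (if n < 2 then 0 else h (n - 2)))"
    by (simp only: fps_add_nth fps_sub_nth fps_mult_left_const_nth fps_X_power_mult_nth fps_deriv_nth
        fps_nth_Abs_fps Suc_eq_plus1)
  have p: "p \<noteq> 0" using z by (simp add: p_def)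
  have w: "w = (1 - 2 * x) * e / p" and S: "S = (e / p)\<^sup>2" and r: "r = 1 / p"
    using z by (simp_all add: w_def S_def r_def p_def e_def field_simps)
  (* The truncated terms come with a factor that vanishes at the boundary index, which
     lowers the truncation bound by one. *)
  have i2: "(if n < 2 then 0 else of_nat (Suc (n - 2)) * h (Suc (n - 2))) =
        (of_nat n - 1) * (if n < 1 then 0 else h (n - 1))"
  proof -
    consider "n = 0" | "n = 1" | m where "n = m + 2"
      by (metis One_nat_def Suc_1 add_2_eq_Suc' not0_implies_Suc)
    then show ?thesis by cases simp_all
  qed
  have i4: "(if n < 4 then 0 else of_nat (Suc (n - 4)) * h (Suc (n - 4))) =
        (of_nat n - 3) * (if n < 3 then 0 else h (n - 3))"
  proof -
    consider "n < 3" | "n = 3" | "4 \<le> n" by linarith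
    then show ?thesis
    proof cases
      case 3
      then obtain m where "n = 4 + m" using le_Suc_ex by blast
      then show ?thesis by (simp add: eval_nat_numeral)
    qed simp_all
  qed
  let ?h1 = "if n < 1 then 0 else h (n - 1)" and ?h2 = "if n < 2 then 0 else h (n - 2)"
    and ?h3 = "if n < 3 then 0 else h (n - 3)"
  have "p\<^sup>2 * (of_nat (Suc n) * h (Suc n)) =
      (1 - 2 * x) * e * (p * h n - ?h2) + (e\<^sup>2 - 2 * p) * (of_nat n - 2) * ?h1 - (of_nat n - 5) * ?h3"
    using rec unfolding i2 i4 by algebra
  then have "of_nat (Suc n) * h (Suc n) =
      ((1 - 2 * x) * e * (p * h n - ?h2) + (e\<^sup>2 - 2 * p) * (of_nat n - 2) * ?h1 - (of_nat n - 5) * ?h3) / p\<^sup>2"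
    using p by (metis nonzero_mult_div_cancel_left power_not_zero)
  also have "\<dots> = w * (h n - r * ?h2) + (S - 2 * r) * (of_nat n - 2) * ?h1 - r\<^sup>2 * (of_nat n - 5) * ?h3"
    using p unfolding w S r by (simp add: field_simps power2_eq_square del: of_nat_Suc)
  finally show ?thesis by (simp only: if_distrib[of "\<lambda>t. r * t"] mult_zero_right)
qed

section \<open>Zeros on the critical line\<close>

theorem theorem5:
  fixes z1 z2 :: real and H :: "nat \<Rightarrow> complex poly"
  assumes "0 < z1" and "z1 < z2"
    and "\<And>x :: complex.
           gen_fun z1 z2 x has_fps_expansion Abs_fps (\<lambda>n. poly (H n) x / fact n)"
  shows "\<exists>N. \<forall>n\<ge>N.
           poly (H n) 0 = 0 \<and> poly (H n) 1 = 0 \<and>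
           (\<forall>x :: complex. poly (H n) x = 0 \<and> x \<noteq> 0 \<and> x \<noteq> 1 \<longrightarrow> Re x = 1 / 2)"
proof -
  define s where "s = 1 / z1 + 1 / z2"
  have z: "0 < z1" "0 < z2" and s: "s > 0" using assms(1,2) by (simp_all add: s_def add_pos_pos)
  define t where "t x n = moment_functional ((1 - 2 * x) * of_real s) (of_real (s\<^sup>2))
      (lucas_poly (of_real (1 / (z1 * z2))) n)" for x n
  have H: "poly (H (n + 3)) x / fact (n + 3) =
      poly (H 0) x * (((1 - 2 * x) * of_real s)\<^sup>2 - of_real (s\<^sup>2)) / 2 * t x (n + 2)" for n x
    using moment_functional_solves_rec[OF gen_fun_coeff_rec[OF z assms(3)], of x n] by (simp add: t_def s_def)
  have H0: "poly (H 0) x \<noteq> 0" for x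
  proof -
    have "gen_fun z1 z2 x 0 = poly (H 0) x"
      using has_fps_expansion_imp_0_eq_fps_nth_0[OF assms(3), of x] by simp
    moreover have "gen_fun z1 z2 x 0 \<noteq> 0" using z by (simp add: gen_fun_def Q_def)
    ultimately show ?thesis by simp
  qed
  have K: "((1 - 2 * x) * of_real s)\<^sup>2 - of_real (s\<^sup>2) = 4 * of_real (s\<^sup>2) * (x * (x - 1))" for x :: complex
    by (simp add: power2_eq_square algebra_simps)
  have t: "t x (n + 2) \<noteq> 0" if "Re x \<noteq> 1 / 2" for x n
  proof -
    have s2: "s\<^sup>2 = 4 * (1 / (z1 * z2)) + (1 / z1 - 1 / z2)\<^sup>2"
      using z by (simp add: s_def field_simps power2_eq_square)
    have "Re ((1 - 2 * x) * of_real s) \<noteq> 0" using that s by simp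
    then show ?thesis
      unfolding t_def s2 add_2_eq_Suc' using z by (intro moment_functional_lucas_poly_nonzero) simp_all
  qed
  have "poly (H n) 0 = 0 \<and> poly (H n) 1 = 0 \<and>
           (\<forall>x :: complex. poly (H n) x = 0 \<and> x \<noteq> 0 \<and> x \<noteq> 1 \<longrightarrow> Re x = 1 / 2)" if n3: "n \<ge> 3" for n
  proof -
    obtain m where n: "n = m + 3" using le_Suc_ex[OF n3] by (auto simp: add.commute)
    have "poly (H n) x = 0 \<longleftrightarrow> x = 0 \<or> x = 1 \<or> t x (m + 2) = 0" for x
    proof -
      have "poly (H n) x = 0 \<longleftrightarrow> poly (H n) x / fact n = 0" by simp
      also have "\<dots> \<longleftrightarrow> x = 0 \<or> x = 1 \<or> t x (m + 2) = 0"
        unfolding n H K using H0[of x] s by simp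
      finally show ?thesis .
    qed
    with t[of _ m] show ?thesis by blast
  qed
  then show ?thesis by blast
qed

end
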